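(* Assume the nonresonance condition: the only function $u^h:N^+\to\mathbb{C}$ with $L^h u^h=0$ on $M^+$ and $u^h|_\gamma=0$ is $u^h=0$. Let $f^h_{\rm adv}$ and $f^h_{\rm amb}$ be finitely supported source vectors on $\mathbb{Z}^d$ with $\operatorname{supp}f^h_{\rm adv}\subseteq M^+$ and $\operatorname{supp}f^h_{\rm amb}\subseteq M^-$, let $u^h_{\rm adv}=G^h\ast f^h_{\rm adv}$, $u^h_{\rm amb}=G^h\ast f^h_{\rm amb}$ and $u^h=u^h_{\rm adv}+u^h_{\rm amb}$. Given the trace $\xi_\gamma=u^h|_\gamma$, pick any compactly (finitely) supported $V^h:\mathbb{Z}^d\to\mathbb{C}$ with $V^h|_\gamma=\xi_\gamma$ and define $$g^h=-(L^hV^h)\cdot\mathbf 1_{M^+}.$$ Then the outgoing solution $\widetilde u^h=G^h\ast(f^h_{\rm adv}+f^h_{\rm amb}+g^h)$ of $L^h\widetilde u^h=f^h_{\rm adv}+f^h_{\rm amb}+g^h$ satisfies $$\widetilde u^h|_{M^-\cup\gamma}=u^h_{\rm amb}|_{M^-\cup\gamma}.$$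
   Context: Lattice and operator. Let $d\in\{2,3\}$, $h>0$, wavenumber $k>0$. Functions on the lattice $\Lambda_h=h\mathbb{Z}^d$ are indexed by $\mathbb{Z}^d$ (node $h\bm m\leftrightarrow\bm m$). The discrete Helmholtz operator is $$(L^hv)_{\bm m}=-\frac1{h^2}\sum_{\bm e\in\mathbb{Z}^d,\,|\bm e|_1=1}(v_{\bm m+\bm e}-v_{\bm m})-k^2v_{\bm m}.$$ Geometry. $\Omega_{\rm in}\subset\mathbb{R}^d$ is a bounded Lipschitz domain, $M^+=\{\bm m\in\mathbb{Z}^d: h\bm m\in\Omega_{\rm in}\}$, $M^-=\{\bm m\in\mathbb{Z}^d: h\bm m\notin\overline{\Omega_{\rm in}}\}$, and no lattice node lies on $\partial\Omega_{\rm in}$, so $\mathbb{Z}^d=M^+\sqcup M^-$. $N^\pm$ is the set of all nodes of the stencils of $L^h$ centred in $M^\pm$: $N^\pm=M^\pm\cup\{\bm m+\bm e:\bm m\in M^\pm,|\bm e|_1=1\}$. The boundary strip is $\gamma=N^+\cap N^-$. $\mathbf{1}_A$ is the indicator of $A$. Lattice Green's function. $$G^h_{\bm m}=\frac1{(2\pi)^d}\int_{[-\pi,\pi]^d}\frac{e^{i\bm m\cdot\bm\theta}}{\sigma(\bm\theta)-k^2h^2+i0^+}\,d\bm\theta,\qquad \sigma(\bm\theta)=\sum_{j=1}^d2(1-\cos\theta_j),$$ where $i0^+$ means the limit $\varepsilon\to0^+$ with $i\varepsilon$ in place of $i0^+$; $(h,k)$ are assumed such that the limit exists. Then $L^hG^h=h^{-2}\delta_{\bm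 0}$. For finitely supported $f$, $(G^h\ast f)_{\bm m}=h^2\sum_{\bm n}G^h_{\bm m-\bm n}f_{\bm n}$, so $L^h(G^h\ast f)=f$; $G^h\ast f$ is called the outgoing solution generated by $f$. *)

theory Defs
  imports "HOL-Analysis.Analysis"
begin

text \<open>
  The lattice \<open>h \<int>\<^sup>d\<close> is indexed by \<open>int ^ 'd\<close>, with \<open>d = CARD('d)\<close>; grid functions are
  functions \<open>int ^ 'd \<Rightarrow> complex\<close>.
\<close>

definition lattice_node :: "real \<Rightarrow> int ^ 'd \<Rightarrow> real ^ 'd" where
  "lattice_node h m = (\<chi> j. h * of_int (m $ j))"

definition l1_norm :: "int ^ 'd \<Rightarrow> int" where
  "l1_norm e = (\<Sum>j\<in>UNIV. \<bar>e $ j\<bar>)"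

definition disc_helmholtz ::
    "real \<Rightarrow> real \<Rightarrow> (int ^ 'd \<Rightarrow> complex) \<Rightarrow> int ^ 'd \<Rightarrow> complex" where
  "disc_helmholtz h k v m =
     - (1 / of_real (h\<^sup>2)) * (\<Sum>e | l1_norm e = 1. v (m + e) - v m) - of_real (k\<^sup>2) * v m"

text \<open>
  Near every boundary point, after a choice of the vertical direction \<open>\<nu>\<close>, the domain is the
  part of a ball lying strictly below the graph of a Lipschitz function on the hyperplane
  orthogonal to \<open>\<nu>\<close>. This forces the boundary within the ball to be that graph.
\<close>

definition bounded_Lipschitz_domain :: "'a::euclidean_space set \<Rightarrow> bool" where
  "bounded_Lipschitz_domain \<Omega> \<longleftrightarrow>
     open \<Omega> \<and> connected \<Omega> \<and> \<Omega> \<noteq> {} \<and> bounded \<Omega> \<and>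
     (\<forall>x\<in>frontier \<Omega>. \<exists>r>0. \<exists>\<nu> (\<phi> :: 'a \<Rightarrow> real) C.
        norm \<nu> = 1 \<and> C-lipschitz_on {y. y \<bullet> \<nu> = 0} \<phi> \<and>
        \<Omega> \<inter> ball x r = {y \<in> ball x r. y \<bullet> \<nu> < \<phi> (y - (y \<bullet> \<nu>) *\<^sub>R \<nu>)})"

definition M_plus :: "real \<Rightarrow> (real ^ 'd) set \<Rightarrow> (int ^ 'd) set" where
  "M_plus h \<Omega> = {m. lattice_node h m \<in> \<Omega>}"

definition M_minus :: "real \<Rightarrow> (real ^ 'd) set \<Rightarrow> (int ^ 'd) set" where
  "M_minus h \<Omega> = {m. lattice_node h m \<notin> closure \<Omega>}"

definition stencil_nodes :: "(int ^ 'd) set \<Rightarrow> (int ^ 'd) set" where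
  "stencil_nodes M = M \<union> {m + e | m e. m \<in> M \<and> l1_norm e = 1}"

definition N_plus :: "real \<Rightarrow> (real ^ 'd) set \<Rightarrow> (int ^ 'd) set" where
  "N_plus h \<Omega> = stencil_nodes (M_plus h \<Omega>)"

definition N_minus :: "real \<Rightarrow> (real ^ 'd) set \<Rightarrow> (int ^ 'd) set" where
  "N_minus h \<Omega> = stencil_nodes (M_minus h \<Omega>)"

definition boundary_strip :: "real \<Rightarrow> (real ^ 'd) set \<Rightarrow> (int ^ 'd) set" where
  "boundary_strip h \<Omega> = N_plus h \<Omega> \<inter> N_minus h \<Omega>"

definition supp :: "(int ^ 'd \<Rightarrow> complex) \<Rightarrow> (int ^ 'd) set" where
  "supp f = {m. f m \<noteq> 0}"

definition lattice_symbol :: "real ^ 'd \<Rightarrow> real" where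
  "lattice_symbol \<theta> = (\<Sum>j\<in>UNIV. 2 * (1 - cos (\<theta> $ j)))"

definition lattice_green_eps :: "real \<Rightarrow> real \<Rightarrow> real \<Rightarrow> int ^ 'd \<Rightarrow> complex" where
  "lattice_green_eps \<epsilon> h k m =
     1 / of_real ((2 * pi) ^ CARD('d)) *
     integral (cbox (\<chi> j. - pi) (\<chi> j. pi) :: (real ^ 'd) set)
       (\<lambda>\<theta>. exp (\<i> * of_real (\<Sum>j\<in>UNIV. of_int (m $ j) * \<theta> $ j)) /
            (of_real (lattice_symbol \<theta> - k\<^sup>2 * h\<^sup>2) + \<i> * of_real \<epsilon>))"

definition limiting_absorption :: "'d::finite itself \<Rightarrow> real \<Rightarrow> real \<Rightarrow> bool" where
  "limiting_absorption _ h k \<longleftrightarrow>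
     (\<forall>m :: int ^ 'd. \<exists>l. ((\<lambda>\<epsilon>. lattice_green_eps \<epsilon> h k m) \<longlongrightarrow> l) (at_right 0))"

text \<open>Meaningful only under \<open>limiting_absorption\<close>; otherwise \<open>Lim\<close> is unspecified.\<close>

definition lattice_green :: "real \<Rightarrow> real \<Rightarrow> int ^ 'd \<Rightarrow> complex" where
  "lattice_green h k m = Lim (at_right 0) (\<lambda>\<epsilon>. lattice_green_eps \<epsilon> h k m)"

text \<open>
  The sum over \<open>supp f\<close> is the convolution sum for finitely supported \<open>f\<close>; for infinite
  support it is \<open>0\<close> by the convention for \<open>sum\<close>.
\<close>

definition outgoing_solution ::
    "real \<Rightarrow> real \<Rightarrow> (int ^ 'd \<Rightarrow> complex) \<Rightarrow> int ^ 'd \<Rightarrow> complex" where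
  "outgoing_solution h k f m =
     of_real (h\<^sup>2) * (\<Sum>n\<in>supp f. lattice_green h k (m - n) * f n)"

text \<open>
  A function on \<open>N\<^sup>+\<close> is represented by a total grid function: for centres in \<open>M\<^sup>+\<close> the
  operator reads only values on \<open>N\<^sup>+\<close>, and only those are asserted to vanish.
\<close>

definition nonresonant :: "real \<Rightarrow> real \<Rightarrow> (real ^ 'd) set \<Rightarrow> bool" where
  "nonresonant h k \<Omega> \<longleftrightarrow>
     (\<forall>u. (\<forall>m\<in>M_plus h \<Omega>. disc_helmholtz h k u m = 0) \<and>
          (\<forall>m\<in>boundary_strip h \<Omega>. u m = 0)
        \<longrightarrow> (\<forall>m\<in>N_plus h \<Omega>. u m = 0))"

end

theory Submission
  imports Defs
begin

text \<open>
  Let \<open>z\<close> be \<open>u - V\<close> on \<open>N\<^sup>+\<close>, extended by zero. As \<open>u = V\<close> on \<open>\<gamma>\<close>, \<open>z\<close> vanishes on \<open>N\<^sup>-\<close>, so \<open>L z = 0\<close>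
  on \<open>M\<^sup>-\<close>, while \<open>L z = f\<^sub>a\<^sub>d\<^sub>v - L V\<close> on \<open>M\<^sup>+\<close>; thus \<open>L z = f\<^sub>a\<^sub>d\<^sub>v + g\<close> everywhere. Since \<open>z\<close> is
  finitely supported and \<open>L\<close> commutes with convolution by \<open>G\<close>, \<open>G * (f\<^sub>a\<^sub>d\<^sub>v + g) = G * L z = z\<close>,
  which is zero on \<open>M\<^sup>- \<union> \<gamma> \<subseteq> N\<^sup>-\<close>. The equation \<open>L G = h\<^sup>-\<^sup>2 \<delta>\<close> follows by letting \<open>\<epsilon>\<close> tend to zero
  in \<open>h\<^sup>2 L G\<^sub>\<epsilon> = \<delta> - i \<epsilon> G\<^sub>\<epsilon>\<close>.
\<close>

section \<open>The nearest-neighbour stencil and plane waves\<close>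

text \<open>Non-negative integers with sum 1 consist of a single 1 and zeros, so one component is 1
  or -1 and all others vanish.\<close>

lemma l1_norm_1_eq:
  "{e :: int ^ 'd::finite. l1_norm e = 1} = range (\<lambda>j. axis j 1) \<union> range (\<lambda>j. axis j (-1))"
proof (intro subset_antisym subsetI)
  fix e :: "int ^ 'd"
  assume "e \<in> {e. l1_norm e = 1}"
  then have sum1: "(\<Sum>j\<in>UNIV. \<bar>e $ j\<bar>) = 1"
    by (simp add: l1_norm_def)
  then obtain j where j: "e $ j \<noteq> 0"
    by (metis abs_zero sum.neutral zero_neq_one)
  have split: "(\<Sum>i\<in>UNIV. \<bar>e $ i\<bar>) = \<bar>e $ j\<bar> + (\<Sum>i\<in>UNIV - {j}. \<bar>e $ i\<bar>)"
    by (simp add: sum.remove)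
  have "(\<Sum>i\<in>UNIV - {j}. \<bar>e $ i\<bar>) \<ge> 0"
    by (simp add: sum_nonneg)
  with split sum1 j have abs_j: "\<bar>e $ j\<bar> = 1" and rest: "(\<Sum>i\<in>UNIV - {j}. \<bar>e $ i\<bar>) = 0"
    by linarith+
  have "e $ i = 0" if "i \<noteq> j" for i
    using rest that by (subst (asm) sum_nonneg_eq_0_iff) auto
  then have e: "e = axis j (e $ j)"
    by (simp add: vec_eq_iff axis_def)
  from abs_j consider "e $ j = 1" | "e $ j = -1"
    by linarith
  then show "e \<in> range (\<lambda>j. axis j 1) \<union> range (\<lambda>j. axis j (-1))"
    by cases (use e in auto)
qed (auto simp: l1_norm_def axis_def if_distrib cong: if_cong)

text \<open>Opposite neighbours are paired so that, on a plane wave, the phases \<open>cis t\<close>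
  and \<open>cis (- t)\<close> of one axis combine into a cosine.\<close>

lemma sum_l1_norm_1:
  fixes F :: "int ^ 'd::finite \<Rightarrow> 'a::comm_monoid_add"
  shows "(\<Sum>e | l1_norm e = 1. F e) = (\<Sum>j\<in>UNIV. F (axis j 1) + F (axis j (-1)))"
proof -
  have "inj (\<lambda>j::'d. axis j (1::int))" "inj (\<lambda>j::'d. axis j (-1::int))"
    by (auto simp: inj_on_def axis_eq_axis)
  moreover have "range (\<lambda>j::'d. axis j (1::int)) \<inter> range (\<lambda>j. axis j (-1)) = {}"
    by (auto simp: axis_eq_axis)
  ultimately show ?thesis
    by (simp add: l1_norm_1_eq sum.union_disjoint sum.reindex sum.distrib)
qed

lemma finite_l1_norm_1: "finite {e :: int ^ 'd::finite. l1_norm e = 1}"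
  by (simp add: l1_norm_1_eq)

text \<open>The numerator of the integrand of \<open>lattice_green_eps\<close>. The node comes
  first, so that \<open>lattice_wave m\<close> is a function on the frequency cube.\<close>

definition lattice_wave :: "int ^ 'd::finite \<Rightarrow> real ^ 'd \<Rightarrow> complex" where
  "lattice_wave m \<theta> = exp (\<i> * of_real (\<Sum>j\<in>UNIV. of_int (m $ j) * \<theta> $ j))"

text \<open>Plane waves are eigenfunctions of the stencil sum: a shift along an axis multiplies them
  by a phase, and each pair of opposite shifts contributes \<open>2 * cos t - 2\<close>.\<close>

lemma sum_lattice_wave:
  "(\<Sum>e | l1_norm e = 1. lattice_wave (m + e) \<theta> - lattice_wave m \<theta>)
     = - of_real (lattice_symbol \<theta>) * lattice_wave m \<theta>"
proof -
  have wave_add: "lattice_wave (m + axis j a) \<theta> = lattice_wave m \<theta> * cis (of_int a * \<theta> $ j)"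
    for j a
  proof -
    have "(\<Sum>i\<in>UNIV. of_int ((m + axis j a) $ i) * \<theta> $ i)
        = (\<Sum>i\<in>UNIV. of_int (m $ i) * \<theta> $ i) + of_int a * \<theta> $ j"
    proof -
      have "(\<Sum>i\<in>UNIV. of_int (axis j a $ i) * \<theta> $ i) = (\<Sum>i\<in>UNIV. if i = j then of_int a * \<theta> $ j else 0)"
        by (rule sum.cong) (auto simp: axis_def)
      then show ?thesis
        by (simp add: distrib_right sum.distrib)
    qed
    then show ?thesis
      by (simp add: lattice_wave_def cis_conv_exp exp_add distrib_left)
  qed
  have cos2: "cis t + cis (- t) - 2 = - of_real (2 * (1 - cos t))" for t
    by (simp add: complex_eq_iff)
  have "(\<Sum>e | l1_norm e = 1. lattice_wave (m + e) \<theta> - lattice_wave m \<theta>)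
      = (\<Sum>j\<in>UNIV. lattice_wave m \<theta> * (cis (\<theta> $ j) + cis (- \<theta> $ j) - 2))"
    unfolding sum_l1_norm_1 wave_add by (simp add: algebra_simps)
  also have "\<dots> = - of_real (lattice_symbol \<theta>) * lattice_wave m \<theta>"
    unfolding vector_uminus_component cos2 lattice_symbol_def of_real_sum
    by (simp only: sum_distrib_left[symmetric] sum_negf mult.commute[of _ "lattice_wave m \<theta>"])
  finally show ?thesis .
qed

section \<open>Orthogonality of plane waves on the frequency cube\<close>

text \<open>For nonzero \<open>n\<close> there is an antiderivative whose exponents at the two
  endpoints differ by \<open>2 * pi * n\<close> times the imaginary unit, a period of
  \<open>exp\<close>.\<close>

lemma integral_exp_int:
  "(LBINT x:{-pi..pi}. exp (\<i> * of_real (of_int n * x))) = (if n = 0 then 2 * of_real pi else 0)"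
proof (cases "n = 0")
  case True
  then show ?thesis 
    by (simp add: set_lebesgue_integral_def scaleR_conv_of_real)
next
  case False
  define F where "F x = exp (\<i> * of_real (of_int n * x)) / (\<i> * of_int n)" for x :: real
  have "((\<lambda>x. exp (\<i> * of_real (of_int n * x))) has_integral (F pi - F (- pi))) {-pi..pi}"
  proof (rule fundamental_theorem_of_calculus)
    fix x
    show "(F has_vector_derivative exp (\<i> * of_real (of_int n * x))) (at x within {-pi..pi})"
    proof -
      have "((\<lambda>z. exp (\<i> * of_int n * z) / (\<i> * of_int n)) has_field_derivative exp (\<i> * of_int n * of_real x))
          (at (of_real x))"
        using False by (auto intro!: derivative_eq_intros)
      from has_vector_derivative_real_field[OF this] show ?thesis
        by (simp add: F_def[abs_def] mult.assoc)
    qed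
  qed simp
  moreover have "F pi = F (- pi)"
  proof -
    have "exp (\<i> * of_real (of_int n * pi)) = exp (\<i> * of_real (of_int n * (- pi)))"
      unfolding exp_eq by (rule exI[of _ n]) (simp add: algebra_simps)
    then show ?thesis
      by (simp add: F_def)
  qed
  moreover have "set_integrable lborel {-pi..pi} (\<lambda>x. exp (\<i> * of_real (of_int n * x)))"
    by (intro borel_integrable_atLeastAtMost' continuous_intros)
  ultimately show ?thesis
    using False by (metis set_borel_integral_eq_integral(2) integral_unique diff_self)
qed

lemma continuous_on_lattice_wave [continuous_intros]: "continuous_on A (lattice_wave m)"
  unfolding lattice_wave_def[abs_def] by (intro continuous_intros)

text \<open>The wave is a product of functions of one coordinate each, so by Fubini its integral is
  a product of one-dimensional integrals. One nonzero component of \<open>m\<close> makes a factor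
  vanish.\<close>

lemma integral_lattice_wave:
  fixes m :: "int ^ 'd::finite"
  shows "integral (cbox (\<chi> j. - pi) (\<chi> j. pi)) (lattice_wave m)
    = (if m = 0 then of_real ((2 * pi) ^ CARD('d)) else 0)"
proof -
  let ?C = "cbox (\<chi> j. - pi) (\<chi> j. pi) :: (real ^ 'd) set"
  \<comment> \<open>The product measure behind \<open>lborel\<close> is indexed by basis vectors,
    whereas \<open>m\<close> is indexed by coordinates; \<open>ix\<close> translates between the
    two.\<close>
  define ix :: "real ^ 'd \<Rightarrow> 'd" where "ix b = (THE j. b = axis j 1)" for b
  have ix: "ix (axis j 1) = j" for j
    by (simp add: ix_def axis_eq_axis)
  \<comment> \<open>Each factor carries its own interval indicator. Their product is the indicator
    of the cube, so the integral can run over the whole space.\<close>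
  define w where "w b x = indicator {-pi..pi} x *\<^sub>R exp (\<i> * of_real (of_int (m $ ix b) * x))"
    for b and x :: real
  have Basis: "Basis = range (\<lambda>j::'d. axis j (1::real))"
    by (auto simp: Basis_vec_def)
  have inj: "inj (\<lambda>j::'d. axis j (1::real))"
    by (auto simp: inj_on_def axis_eq_axis)
  have int_wave: "set_integrable lborel ?C (lattice_wave m)"
    unfolding set_integrable_def
    by (intro borel_integrable_compact continuous_intros) simp
  interpret product_sigma_finite "\<lambda>_. lborel :: real measure"
    by standard
  have w_int: "integrable lborel (w b)" for b
    unfolding w_def
    by (intro borel_integrable_compact continuous_intros) simp
  have "integral ?C (lattice_wave m) = (LBINT \<theta>:?C. lattice_wave m \<theta>)"
    using set_borel_integral_eq_integral(2)[OF int_wave] by simp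
  also have "\<dots> = (\<integral>\<theta>. (\<Prod>b\<in>Basis. w b (\<theta> \<bullet> b)) \<partial>lborel)"
    unfolding set_lebesgue_integral_def
  proof (rule Bochner_Integration.integral_cong[OF refl])
    fix \<theta> :: "real ^ 'd"
    have "(\<Prod>b\<in>Basis. w b (\<theta> \<bullet> b)) = (\<Prod>j\<in>UNIV. w (axis j 1) (\<theta> $ j))"
      unfolding Basis by (simp add: prod.reindex[OF inj] inner_axis)
    also have "\<dots> = (\<Prod>j\<in>UNIV. indicator {-pi..pi} (\<theta> $ j)) *\<^sub>R lattice_wave m \<theta>"
      by (simp add: lattice_wave_def w_def ix scaleR_conv_of_real prod.distrib exp_sum sum_distrib_left)
    also have "(\<Prod>j\<in>UNIV. indicator {-pi..pi} (\<theta> $ j)) = (indicator ?C \<theta> :: real)"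
      by (auto simp: indicator_def mem_box_cart)
    finally show "indicator ?C \<theta> *\<^sub>R lattice_wave m \<theta> = (\<Prod>b\<in>Basis. w b (\<theta> \<bullet> b))" ..
  qed
  also have "\<dots> = (\<Prod>b\<in>(Basis :: (real ^ 'd) set). \<integral>x. w b x \<partial>lborel)"
  proof -
    have "(\<integral>\<theta>. (\<Prod>b\<in>Basis. w b (\<theta> \<bullet> b)) \<partial>(lborel :: (real ^ 'd) measure))
        = (\<integral>x. (\<Prod>b\<in>Basis. w b ((\<Sum>b\<in>Basis. x b *\<^sub>R b) \<bullet> b)) \<partial>(\<Pi>\<^sub>M b\<in>(Basis :: (real ^ 'd) set). lborel))"
      \<comment> \<open>\<open>lborel\<close> is the image of the product measure under the map from
        coordinates to linear combinations of basis vectors.\<close>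
      unfolding lborel_eq[where 'a = "real ^ 'd"] using borel_measurable_integrable[OF w_int]
      by (intro integral_distr) simp_all
    also have "\<dots> = (\<integral>x. (\<Prod>b\<in>Basis. w b (x b)) \<partial>(\<Pi>\<^sub>M b\<in>(Basis :: (real ^ 'd) set). lborel))"
      by simp
    also have "\<dots> = (\<Prod>b\<in>(Basis :: (real ^ 'd) set). \<integral>x. w b x \<partial>lborel)"
      by (rule product_integral_prod) (simp_all add: w_int)
    finally show ?thesis .
  qed
  also have "\<dots> = (\<Prod>j\<in>UNIV. if m $ j = 0 then 2 * of_real pi else 0)"
    unfolding Basis prod.reindex[OF inj] w_def integral_exp_int[unfolded set_lebesgue_integral_def]
    by (simp add: ix)
  also have "\<dots> = (if m = 0 then of_real ((2 * pi) ^ CARD('d)) else 0)"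
    by (auto simp: vec_eq_iff)
  finally show ?thesis .
qed

section \<open>The equation of the Green's function\<close>

text \<open>Under the integral, the operator times \<open>h\<^sup>2\<close> multiplies the wave by
  its symbol, which is the denominator minus \<open>\<i> * of_real \<epsilon>\<close>. The
  denominator cancels and leaves a pure wave, whose integral is the delta; the remainder is a
  multiple of \<open>lattice_green_eps\<close> itself.\<close>

lemma disc_helmholtz_lattice_green_eps:
  fixes m :: "int ^ 'd::finite"
  assumes h: "h > 0" and \<epsilon>: "\<epsilon> > 0"
  shows "disc_helmholtz h k (lattice_green_eps \<epsilon> h k) m
    = ((if m = 0 then 1 else 0) - \<i> * of_real \<epsilon> * lattice_green_eps \<epsilon> h k m) / of_real (h\<^sup>2)"
proof -
  let ?C = "cbox (\<chi> j. - pi) (\<chi> j. pi) :: (real ^ 'd) set"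
  define c :: complex where "c = 1 / of_real ((2 * pi) ^ CARD('d))"
  define D where "D \<theta> = of_real (lattice_symbol \<theta> - k\<^sup>2 * h\<^sup>2) + \<i> * of_real \<epsilon>" for \<theta> :: "real ^ 'd"
  \<comment> \<open>The imaginary part is the positive \<open>\<epsilon>\<close>; hence the
    integrand is continuous on the whole cube, even where the symbol equals
    \<open>k\<^sup>2 * h\<^sup>2\<close>.\<close>
  have D0: "D \<theta> \<noteq> 0" for \<theta>
    using \<epsilon> by (simp add: D_def complex_eq_iff)
  have G: "lattice_green_eps \<epsilon> h k n = c * integral ?C (\<lambda>\<theta>. lattice_wave n \<theta> / D \<theta>)" for n
    by (simp add: lattice_green_eps_def c_def D_def lattice_wave_def)
  have [continuous_intros]: "continuous_on ?C D"
    unfolding D_def lattice_symbol_def by (intro continuous_intros)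
  have int: "(\<lambda>\<theta>. lattice_wave n \<theta> / D \<theta>) integrable_on ?C" for n
    by (intro integrable_continuous continuous_intros) (simp add: D0)
  have int_wave: "lattice_wave n integrable_on ?C" for n
    by (intro integrable_continuous continuous_intros)
  have "(\<Sum>e | l1_norm e = 1. lattice_green_eps \<epsilon> h k (m + e) - lattice_green_eps \<epsilon> h k m)
      = c * integral ?C (\<lambda>\<theta>. \<Sum>e | l1_norm e = 1. lattice_wave (m + e) \<theta> / D \<theta> - lattice_wave m \<theta> / D \<theta>)"
    unfolding G
    by (simp only: integral_sum[OF finite_l1_norm_1 integrable_diff[OF int int]]
        Henstock_Kurzweil_Integration.integral_diff[OF int int] right_diff_distrib sum_distrib_left)
  also have "(\<lambda>\<theta>. \<Sum>e | l1_norm e = 1. lattice_wave (m + e) \<theta> / D \<theta> - lattice_wave m \<theta> / D \<theta>)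
      = (\<lambda>\<theta>. (\<i> * of_real \<epsilon> - of_real (k\<^sup>2 * h\<^sup>2)) * (lattice_wave m \<theta> / D \<theta>) - lattice_wave m \<theta>)"
  proof
    fix \<theta>
    have "(\<Sum>e | l1_norm e = 1. lattice_wave (m + e) \<theta> / D \<theta> - lattice_wave m \<theta> / D \<theta>)
        = - of_real (lattice_symbol \<theta>) * lattice_wave m \<theta> / D \<theta>"
      by (simp only: diff_divide_distrib[symmetric] sum_divide_distrib[symmetric] sum_lattice_wave)
    also have "- of_real (lattice_symbol \<theta>) = \<i> * of_real \<epsilon> - of_real (k\<^sup>2 * h\<^sup>2) - D \<theta>"
      by (simp add: D_def)
    finally show "(\<Sum>e | l1_norm e = 1. lattice_wave (m + e) \<theta> / D \<theta> - lattice_wave m \<theta> / D \<theta>)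
        = (\<i> * of_real \<epsilon> - of_real (k\<^sup>2 * h\<^sup>2)) * (lattice_wave m \<theta> / D \<theta>) - lattice_wave m \<theta>"
      by (simp only: left_diff_distrib diff_divide_distrib times_divide_eq_right
          nonzero_mult_div_cancel_left[OF D0] mult.assoc)
  qed
  also have "integral ?C \<dots> = (\<i> * of_real \<epsilon> - of_real (k\<^sup>2 * h\<^sup>2)) * integral ?C (\<lambda>\<theta>. lattice_wave m \<theta> / D \<theta>)
      - integral ?C (lattice_wave m)"
    by (subst Henstock_Kurzweil_Integration.integral_diff)
      (simp_all only: integral_mult_right integrable_on_mult_right int int_wave)
  also have "c * \<dots> = (\<i> * of_real \<epsilon> - of_real (k\<^sup>2 * h\<^sup>2)) * lattice_green_eps \<epsilon> h k m
      - (if m = 0 then 1 else 0)"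
    unfolding integral_lattice_wave G by (simp add: right_diff_distrib c_def)
  finally have "(\<Sum>e | l1_norm e = 1. lattice_green_eps \<epsilon> h k (m + e) - lattice_green_eps \<epsilon> h k m)
      = (\<i> * of_real \<epsilon> - of_real (k\<^sup>2 * h\<^sup>2)) * lattice_green_eps \<epsilon> h k m - (if m = 0 then 1 else 0)" .
  then show ?thesis
    using h unfolding disc_helmholtz_def by (simp add: field_simps)
qed

lemma disc_helmholtz_lattice_green:
  fixes m :: "int ^ 'd::finite"
  assumes h: "h > 0" and lim: "limiting_absorption TYPE('d) h k"
  shows "disc_helmholtz h k (lattice_green h k) m = (if m = 0 then 1 / of_real (h\<^sup>2) else 0)"
proof -
  have G: "((\<lambda>\<epsilon>. lattice_green_eps \<epsilon> h k n) \<longlongrightarrow> lattice_green h k n) (at_right 0)" for n :: "int ^ 'd"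
    using lim unfolding limiting_absorption_def lattice_green_def
    by (metis tendsto_Lim trivial_limit_at_right_real)
  \<comment> \<open>The stencil is finite, so pointwise convergence passes through the
    operator.\<close>
  have "((\<lambda>\<epsilon>. disc_helmholtz h k (lattice_green_eps \<epsilon> h k) m)
      \<longlongrightarrow> disc_helmholtz h k (lattice_green h k) m) (at_right 0)"
    unfolding disc_helmholtz_def by (intro tendsto_intros G)
  moreover have "((\<lambda>\<epsilon>. disc_helmholtz h k (lattice_green_eps \<epsilon> h k) m)
      \<longlongrightarrow> ((if m = 0 then 1 else 0) - \<i> * of_real 0 * lattice_green h k m) / of_real (h\<^sup>2)) (at_right 0)"
  proof (rule Lim_transform_eventually)
    show "((\<lambda>\<epsilon>. ((if m = 0 then 1 else 0) - \<i> * of_real \<epsilon> * lattice_green_eps \<epsilon> h k m) / of_real (h\<^sup>2))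
      \<longlongrightarrow> ((if m = 0 then 1 else 0) - \<i> * of_real 0 * lattice_green h k m) / of_real (h\<^sup>2)) (at_right 0)"
      using h by (intro tendsto_intros G) auto
    show "\<forall>\<^sub>F \<epsilon> in at_right 0.
        ((if m = 0 then 1 else 0) - \<i> * of_real \<epsilon> * lattice_green_eps \<epsilon> h k m) / of_real (h\<^sup>2)
        = disc_helmholtz h k (lattice_green_eps \<epsilon> h k) m"
      using eventually_at_right_less
      by eventually_elim (simp only: disc_helmholtz_lattice_green_eps[OF h])
  qed
  ultimately have "disc_helmholtz h k (lattice_green h k) m
      = ((if m = 0 then 1 else 0) - \<i> * of_real 0 * lattice_green h k m) / of_real (h\<^sup>2)"
    by (rule tendsto_unique[OF trivial_limit_at_right_real])
  then show ?thesis
    by simp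
qed

section \<open>Convolution with finitely supported sources\<close>

text \<open>The index set in the definition varies with the source. A common finite superset adds
  only zero terms and lets convolutions of different sources be compared term by term.\<close>

lemma outgoing_solution_superset:
  assumes "finite S" and "supp f \<subseteq> S"
  shows "outgoing_solution h k f m = of_real (h\<^sup>2) * (\<Sum>n\<in>S. lattice_green h k (m - n) * f n)"
proof -
  have "(\<Sum>n\<in>supp f. lattice_green h k (m - n) * f n) = (\<Sum>n\<in>S. lattice_green h k (m - n) * f n)"
    using assms by (intro sum.mono_neutral_left) (auto simp: supp_def)
  then show ?thesis
    by (simp add: outgoing_solution_def)
qed

lemma supp_add: "supp (\<lambda>n. f n + g n) \<subseteq> supp f \<union> supp g"
  and supp_cmult: "supp (\<lambda>n. c * f n) \<subseteq> supp f"
  and supp_sum: "supp (\<lambda>n. \<Sum>i\<in>I. F i n) \<subseteq> (\<Union>i\<in>I. supp (F i))"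
  by (auto simp: supp_def intro: sum.neutral)

lemma outgoing_solution_add:
  assumes "finite (supp f)" and "finite (supp g)"
  shows "outgoing_solution h k (\<lambda>n. f n + g n) m = outgoing_solution h k f m + outgoing_solution h k g m"
proof -
  have "finite (supp f \<union> supp g)"
    using assms by simp
  note superset = outgoing_solution_superset[OF this]
  show ?thesis
    by (simp add: superset supp_add distrib_left sum.distrib)
qed

lemma outgoing_solution_cmult:
  assumes "finite (supp f)"
  shows "outgoing_solution h k (\<lambda>n. c * f n) m = c * outgoing_solution h k f m"
  by (simp add: outgoing_solution_superset[OF assms] supp_cmult sum_distrib_left mult.left_commute)

lemma outgoing_solution_sum:
  assumes "finite I" and "\<And>i. i \<in> I \<Longrightarrow> finite (supp (F i))"
  shows "outgoing_solution h k (\<lambda>n. \<Sum>i\<in>I. F i n) m = (\<Sum>i\<in>I. outgoing_solution h k (F i) m)"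
proof -
  define S where "S = (\<Union>i\<in>I. supp (F i))"
  have S: "supp (F i) \<subseteq> S" if "i \<in> I" for i
    using that by (auto simp: S_def)
  have "finite S"
    using assms by (auto simp: S_def)
  have "outgoing_solution h k (\<lambda>n. \<Sum>i\<in>I. F i n) m
      = of_real (h\<^sup>2) * (\<Sum>n\<in>S. lattice_green h k (m - n) * (\<Sum>i\<in>I. F i n))"
    using \<open>finite S\<close> supp_sum[of F I] unfolding S_def by (rule outgoing_solution_superset)
  also have "\<dots> = (\<Sum>i\<in>I. of_real (h\<^sup>2) * (\<Sum>n\<in>S. lattice_green h k (m - n) * F i n))"
    by (subst sum_distrib_left, subst sum.swap) (simp add: sum_distrib_left)
  also have "\<dots> = (\<Sum>i\<in>I. outgoing_solution h k (F i) m)"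
    by (intro sum.cong refl) (simp only: outgoing_solution_superset[OF \<open>finite S\<close> S])
  finally show ?thesis .
qed

lemma supp_translate: "supp (\<lambda>n. f (n + e)) = (\<lambda>p. p - e) ` supp f"
  by (auto simp: supp_def image_iff) (metis add_diff_cancel_right')

text \<open>Reindexing by the shift moves it from the source to the point of evaluation. The
  reindexing is a bijection of supports, so finiteness is not an issue.\<close>

lemma outgoing_solution_translate:
  "outgoing_solution h k (\<lambda>n. f (n + e)) m = outgoing_solution h k f (m + e)"
  by (simp add: outgoing_solution_def supp_translate sum.reindex inj_on_def algebra_simps)

text \<open>
  No subtraction occurs here, so that the rules for sums, scalar multiples and translates of
  finitely supported functions apply syntactically.
\<close>

lemma disc_helmholtz_alt:
  "disc_helmholtz h k f m
    = (\<Sum>e | l1_norm e = 1. (- (1 / of_real (h\<^sup>2))) * (f (m + e) + (- 1) * f m)) + (- of_real (k\<^sup>2)) * f m"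
  by (simp add: disc_helmholtz_def sum_distrib_left)

lemma finite_supp_add: "finite (supp f) \<Longrightarrow> finite (supp g) \<Longrightarrow> finite (supp (\<lambda>n. f n + g n))"
  and finite_supp_cmult: "finite (supp f) \<Longrightarrow> finite (supp (\<lambda>n. c * f n))"
  and finite_supp_translate: "finite (supp f) \<Longrightarrow> finite (supp (\<lambda>n. f (n + e)))"
  by (auto simp: supp_translate intro: finite_subset[OF supp_add] finite_subset[OF supp_cmult])

lemma finite_supp_sum:
  "finite I \<Longrightarrow> (\<And>i. i \<in> I \<Longrightarrow> finite (supp (F i))) \<Longrightarrow> finite (supp (\<lambda>n. \<Sum>i\<in>I. F i n))"
  by (rule finite_subset[OF supp_sum]) simp

lemma finite_supp_disc_helmholtz:
  assumes "finite (supp f)"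
  shows "finite (supp (disc_helmholtz h k f))"
  unfolding disc_helmholtz_alt[abs_def]
  by (intro finite_supp_add finite_supp_cmult finite_supp_sum finite_l1_norm_1
      finite_supp_translate assms)

text \<open>The operator is a finite linear combination of translations, and convolution commutes
  with each of them.\<close>

lemma outgoing_solution_disc_helmholtz:
  assumes "finite (supp f)"
  shows "outgoing_solution h k (disc_helmholtz h k f) m = disc_helmholtz h k (outgoing_solution h k f) m"
  unfolding disc_helmholtz_alt[abs_def]
  by (simp only: outgoing_solution_add outgoing_solution_cmult outgoing_solution_sum
      finite_supp_add finite_supp_cmult finite_supp_sum finite_l1_norm_1
      finite_supp_translate outgoing_solution_translate assms)

text \<open>The operator acts on the variable \<open>m\<close> alone, hence on the kernel inside the
  finite sum. There the Green's function equation leaves only the term \<open>n = m\<close>.\<close>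

lemma disc_helmholtz_outgoing_solution:
  fixes f :: "int ^ 'd::finite \<Rightarrow> complex"
  assumes h: "h > 0" and lim: "limiting_absorption TYPE('d) h k" and fin: "finite (supp f)"
  shows "disc_helmholtz h k (outgoing_solution h k f) m = f m"
proof -
  let ?G = "lattice_green h k :: int ^ 'd \<Rightarrow> complex"
  have "disc_helmholtz h k (outgoing_solution h k f) m
      = of_real (h\<^sup>2) * (\<Sum>n\<in>supp f. disc_helmholtz h k ?G (m - n) * f n)"
  proof -
    have "(\<Sum>e | l1_norm e = 1. outgoing_solution h k f (m + e) - outgoing_solution h k f m)
        = of_real (h\<^sup>2) * (\<Sum>n\<in>supp f. (\<Sum>e | l1_norm e = 1. ?G (m - n + e) - ?G (m - n)) * f n)"
      unfolding outgoing_solution_def sum_distrib_right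
      by (subst sum.swap) (simp add: sum_distrib_left sum_subtractf algebra_simps)
    moreover have "(\<Sum>n\<in>supp f. disc_helmholtz h k ?G (m - n) * f n)
        = - (1 / of_real (h\<^sup>2)) * (\<Sum>n\<in>supp f. (\<Sum>e | l1_norm e = 1. ?G (m - n + e) - ?G (m - n)) * f n)
          - of_real (k\<^sup>2) * (\<Sum>n\<in>supp f. ?G (m - n) * f n)"
      unfolding disc_helmholtz_def sum_distrib_left[of _ _ "supp f"] sum_subtractf[symmetric]
      by (intro sum.cong refl) (simp only: left_diff_distrib[of _ _ "f _"] mult.assoc)
    ultimately show ?thesis
      by (simp only: disc_helmholtz_def[of h k "outgoing_solution h k f"]
          outgoing_solution_def[of h k f m] right_diff_distrib mult.left_commute)
  qed
  also have "\<dots> = of_real (h\<^sup>2) * (\<Sum>n\<in>supp f. if n = m then f m / of_real (h\<^sup>2) else 0)"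
    unfolding disc_helmholtz_lattice_green[OF h lim] by (intro arg_cong2[of _ _ _ _ "(*)"] sum.cong) auto
  \<comment> \<open>If \<open>m\<close> lies outside the support, the sum is zero, and so is
    \<open>f m\<close>.\<close>
  also have "\<dots> = f m"
    using fin h by (simp add: supp_def)
  finally show ?thesis .
qed

section \<open>Locality of the operator and finiteness of the interior nodes\<close>

text \<open>Locality: a function defined piecewise may be replaced by one of its pieces at any
  centre whose whole stencil lies in that piece.\<close>

lemma disc_helmholtz_cong:
  assumes "v m = w m" and "\<And>e. l1_norm e = 1 \<Longrightarrow> v (m + e) = w (m + e)"
  shows "disc_helmholtz h k v m = disc_helmholtz h k w m"
  using assms by (simp add: disc_helmholtz_def)

lemma disc_helmholtz_add:
  "disc_helmholtz h k (\<lambda>m. v m + w m) m = disc_helmholtz h k v m + disc_helmholtz h k w m"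
  unfolding disc_helmholtz_def add_diff_add sum.distrib by (simp add: algebra_simps)

lemma disc_helmholtz_diff:
  "disc_helmholtz h k (\<lambda>m. v m - w m) m = disc_helmholtz h k v m - disc_helmholtz h k w m"
  using disc_helmholtz_add[of h k "\<lambda>m. v m - w m" w m] by simp

lemma finite_bounded_int_vec: "finite {m :: int ^ 'd::finite. \<forall>j. \<bar>m $ j\<bar> \<le> B}"
proof (rule finite_subset)
  show "{m :: int ^ 'd. \<forall>j. \<bar>m $ j\<bar> \<le> B} \<subseteq> vec_lambda ` (UNIV \<rightarrow>\<^sub>E {-B..B})"
  proof
    fix m :: "int ^ 'd"
    assume "m \<in> {m. \<forall>j. \<bar>m $ j\<bar> \<le> B}"
    then have "vec_nth m \<in> UNIV \<rightarrow>\<^sub>E {-B..B}"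
      by (auto simp: abs_le_iff) (metis neg_le_iff_le minus_minus)
    then show "m \<in> vec_lambda ` (UNIV \<rightarrow>\<^sub>E {-B..B})"
      by (metis image_eqI vec_nth_inverse)
  qed
qed (intro finite_imageI finite_PiE, simp_all)

text \<open>A bound \<open>B\<close> on the norm in the domain bounds every integer coordinate by
  \<open>B / h\<close>. This is what makes the cut-off difference in the main proof finitely
  supported.\<close>

lemma finite_M_plus:
  fixes \<Omega> :: "(real ^ 'd::finite) set"
  assumes h: "h > 0" and "bounded \<Omega>"
  shows "finite (M_plus h \<Omega>)"
proof -
  from \<open>bounded \<Omega>\<close> obtain B where B: "norm x \<le> B" if "x \<in> \<Omega>" for x
    by (auto simp: bounded_iff)
  have "M_plus h \<Omega> \<subseteq> {m. \<forall>j. \<bar>m $ j\<bar> \<le> \<lceil>B / h\<rceil>}"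
  proof (intro subsetI CollectI allI)
    fix m j
    assume "m \<in> M_plus h \<Omega>"
    then have "norm (lattice_node h m) \<le> B"
      by (simp add: M_plus_def B)
    then have "\<bar>lattice_node h m $ j\<bar> \<le> B"
      using component_le_norm_cart order_trans by blast
    then have "of_int \<bar>m $ j\<bar> \<le> B / h"
      using h by (simp add: lattice_node_def abs_mult field_simps)
    then show "\<bar>m $ j\<bar> \<le> \<lceil>B / h\<rceil>"
      by linarith
  qed
  then show ?thesis
    using finite_bounded_int_vec finite_subset by blast
qed

lemma finite_stencil_nodes:
  fixes M :: "(int ^ 'd::finite) set"
  assumes "finite M"
  shows "finite (stencil_nodes M)"
proof -
  have "{m + e | m e. m \<in> M \<and> l1_norm e = 1} = (\<lambda>(m, e). m + e) ` (M \<times> {e. l1_norm e = 1})"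
    by auto
  then show ?thesis
    using assms by (simp add: stencil_nodes_def finite_l1_norm_1)
qed

section \<open>Cancellation of the interior sources outside the domain\<close>

theorem theorem5p1:
  fixes h k :: real
    and \<Omega> :: "(real ^ 'd::finite) set"
    and f_adv f_amb u_adv u_amb u V g u_tilde :: "int ^ 'd \<Rightarrow> complex"
  assumes dim: "CARD('d) \<in> {2, 3}"
    and h_pos: "h > 0" and k_pos: "k > 0"
    and domain: "bounded_Lipschitz_domain \<Omega>"
    and no_boundary_node: "\<And>m :: int ^ 'd. lattice_node h m \<notin> frontier \<Omega>"
    and green_limit: "limiting_absorption TYPE('d) h k"
    and nonres: "nonresonant h k \<Omega>"
    and fin_adv: "finite (supp f_adv)" and supp_adv: "supp f_adv \<subseteq> M_plus h \<Omega>"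
    and fin_amb: "finite (supp f_amb)" and supp_amb: "supp f_amb \<subseteq> M_minus h \<Omega>"
    and u_adv: "u_adv = outgoing_solution h k f_adv"
    and u_amb: "u_amb = outgoing_solution h k f_amb"
    and u: "u = (\<lambda>m. u_adv m + u_amb m)"
    and fin_V: "finite (supp V)"
    and trace_V: "\<And>m. m \<in> boundary_strip h \<Omega> \<Longrightarrow> V m = u m"
    and g: "g = (\<lambda>m. - disc_helmholtz h k V m * indicator (M_plus h \<Omega>) m)"
    and u_tilde: "u_tilde = outgoing_solution h k (\<lambda>m. f_adv m + f_amb m + g m)"
  shows "(\<forall>m. disc_helmholtz h k u_tilde m = f_adv m + f_amb m + g m) \<and>
         (\<forall>m \<in> M_minus h \<Omega> \<union> boundary_strip h \<Omega>. u_tilde m = u_amb m)"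
proof (intro conjI ballI allI)
  let ?Mp = "M_plus h \<Omega>" and ?Mm = "M_minus h \<Omega>"
  \<comment> \<open>A node outside the domain is outside its interior; not being on the frontier, it
    is then outside the closure.\<close>
  have partition: "m \<in> ?Mp \<or> m \<in> ?Mm" and disjoint: "m \<in> ?Mp \<Longrightarrow> m \<notin> ?Mm" for m
    using no_boundary_node[of m] interior_subset[of \<Omega>] closure_subset[of \<Omega>]
    by (auto simp: M_plus_def M_minus_def frontier_def)
  have fin_g: "finite (supp g)"
  proof (rule finite_subset)
    show "supp g \<subseteq> supp (disc_helmholtz h k V)"
      by (auto simp: supp_def g)
  qed (rule finite_supp_disc_helmholtz[OF fin_V])

  define z where "z m = (if m \<in> N_plus h \<Omega> then u m - V m else 0)" for m
  have fin_z: "finite (supp z)"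
  proof (rule finite_subset)
    show "supp z \<subseteq> N_plus h \<Omega>"
      by (auto simp: supp_def z_def)
    show "finite (N_plus h \<Omega>)"
      using h_pos domain
      by (simp add: N_plus_def finite_stencil_nodes finite_M_plus bounded_Lipschitz_domain_def)
  qed
  \<comment> \<open>Such a node is either outside \<open>N_plus h \<Omega>\<close>, where
    \<open>z\<close> is zero by definition, or in the strip, where \<open>V\<close> and
    \<open>u\<close> agree.\<close>
  have z_0: "z m = 0" if "m \<in> N_minus h \<Omega>" for m
    using that trace_V[of m] by (auto simp: z_def boundary_strip_def)
  have Lu: "disc_helmholtz h k u m = f_adv m + f_amb m" for m
    unfolding u u_adv u_amb disc_helmholtz_add
    by (simp add: disc_helmholtz_outgoing_solution h_pos green_limit fin_adv fin_amb)
  have Lz: "disc_helmholtz h k z = (\<lambda>m. f_adv m + g m)"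
  proof
    fix m
    show "disc_helmholtz h k z m = f_adv m + g m"
    proof (cases "m \<in> ?Mp")
      case True
      \<comment> \<open>The whole stencil of an interior centre lies in
        \<open>N_plus h \<Omega>\<close>.\<close>
      then have "disc_helmholtz h k z m = disc_helmholtz h k (\<lambda>m. u m - V m) m"
        by (intro disc_helmholtz_cong) (auto simp: z_def N_plus_def stencil_nodes_def)
      moreover have "f_amb m = 0"
        using supp_amb disjoint[OF True] by (auto simp: supp_def)
      ultimately show ?thesis
        using True by (simp add: disc_helmholtz_diff Lu g)
    next
      case False
      with partition have "m \<in> ?Mm"
        by blast
      \<comment> \<open>The whole stencil of an exterior centre lies in
        \<open>N_minus h \<Omega>\<close>, where \<open>z\<close> vanishes.\<close>
      then have "disc_helmholtz h k z m = disc_helmholtz h k (\<lambda>m. 0) m"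
        by (intro disc_helmholtz_cong z_0) (auto simp: N_minus_def stencil_nodes_def)
      moreover have "f_adv m = 0"
        using supp_adv False by (auto simp: supp_def)
      ultimately show ?thesis
        using False by (simp add: disc_helmholtz_def g)
    qed
  qed

  have fin: "finite (supp (\<lambda>m. f_adv m + g m))"
    by (intro finite_supp_add fin_adv fin_g)
  \<comment> \<open>Regrouped so that the part added to \<open>f_amb\<close> is exactly the image of
    \<open>z\<close> under the operator.\<close>
  have f_eq: "(\<lambda>m. f_adv m + f_amb m + g m) = (\<lambda>m. f_amb m + (f_adv m + g m))"
    by (simp add: algebra_simps)
  show "disc_helmholtz h k u_tilde m = f_adv m + f_amb m + g m" for m
    unfolding u_tilde
    by (intro disc_helmholtz_outgoing_solution h_pos green_limit finite_supp_add fin_adv fin_amb fin_g)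

  fix m
  assume "m \<in> ?Mm \<union> boundary_strip h \<Omega>"
  then have "m \<in> N_minus h \<Omega>"
    by (auto simp: boundary_strip_def N_minus_def stencil_nodes_def)
  have "u_tilde m = u_amb m + outgoing_solution h k (disc_helmholtz h k z) m"
    unfolding u_tilde f_eq u_amb Lz by (rule outgoing_solution_add[OF fin_amb fin])
  \<comment> \<open>Finite support of \<open>z\<close> allows the operator to be moved outside the
    convolution, where it inverts it.\<close>
  also have "outgoing_solution h k (disc_helmholtz h k z) m = z m"
    using fin_z by (simp only: outgoing_solution_disc_helmholtz
        disc_helmholtz_outgoing_solution[OF h_pos green_limit])
  also have "z m = 0"
    using \<open>m \<in> N_minus h \<Omega>\<close> by (rule z_0)
  finally show "u_tilde m = u_amb m"
    by simp
qed

end
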